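(* Every codimension one foliation of degree $1$ on $\mathbf{C}\mathbf{P}(n)$ is an $\mathscr{L}$-foliation.
   Context: A codimension one foliation $\mathscr{F}$ of degree $\nu$ on $\mathbf{C}\mathbf{P}(n)$ is given in homogeneous coordinates by a $1$-form $\omega=\sum_{k=0}^nA_kdz_k$ on $\mathbf{C}^{n+1}$, with $A_k$ homogeneous polynomials of degree $\nu+1$, $\omega\wedge d\omega=0$, $\sum z_kA_k=0$, and $\{A_0=\dots=A_n=0\}$ of codimension $\geq2$. Let $\chi(\mathbf{C}\mathbf{P}(n))$ be the Lie algebra of holomorphic vector fields on $\mathbf{C}\mathbf{P}(n)$. $\mathscr{F}$ is an $\mathscr{L}$-foliation if there is a Lie subalgebra $\mathscr{L}\subset\chi(\mathbf{C}\mathbf{P}(n))$ such that, for generic $z$, $\mathscr{L}(z)=\{X(z):X\in\mathscr{L}\}$ is the tangent space at $z$ to the leaf of $\mathscr{F}$ (so it has dimension $n-1$). *)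

theory Defs
  imports "HOL-Analysis.Analysis" "HOL-Library.Extended_Nat"
begin

text \<open>
  The \<open>n + 1\<close> homogeneous coordinates on \<open>CP(n)\<close> are indexed by a finite type \<open>'m\<close> with
  \<open>CARD('m) = n + 1\<close>, so that \<open>C^(n+1)\<close> is \<^typ>\<open>complex ^ 'm\<close> and a free type variable \<open>'m\<close>
  stands for an arbitrary \<open>n\<close>.
\<close>

section \<open>Polynomials and algebraic subsets of affine space\<close>

text \<open>Since the complex field is infinite, polynomials are identified with polynomial functions.\<close>

definition monomial_fun :: "('m::finite \<Rightarrow> nat) \<Rightarrow> complex ^ 'm \<Rightarrow> complex" where
  "monomial_fun e z = (\<Prod>i\<in>UNIV. z $ i ^ e i)"

definition polynomial_fun :: "(complex ^ 'm::finite \<Rightarrow> complex) \<Rightarrow> bool" where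
  "polynomial_fun f \<longleftrightarrow>
     (\<exists>S c. finite S \<and> f = (\<lambda>z. \<Sum>e\<in>S. c e * monomial_fun e z))"

definition homogeneous_fun :: "nat \<Rightarrow> (complex ^ 'm::finite \<Rightarrow> complex) \<Rightarrow> bool" where
  "homogeneous_fun d f \<longleftrightarrow>
     (\<exists>S c. finite S \<and> (\<forall>e\<in>S. (\<Sum>i\<in>UNIV. e i) = d) \<and>
            f = (\<lambda>z. \<Sum>e\<in>S. c e * monomial_fun e z))"

definition algebraic_set :: "(complex ^ 'm::finite) set \<Rightarrow> bool" where
  "algebraic_set Z \<longleftrightarrow>
     (\<exists>F. (\<forall>f\<in>F. polynomial_fun f) \<and> Z = {z. \<forall>f\<in>F. f z = 0})"

definition irreducible_algebraic_set :: "(complex ^ 'm::finite) set \<Rightarrow> bool" where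
  "irreducible_algebraic_set Z \<longleftrightarrow>
     algebraic_set Z \<and> Z \<noteq> {} \<and>
     (\<forall>Z1 Z2. algebraic_set Z1 \<longrightarrow> algebraic_set Z2 \<longrightarrow> Z = Z1 \<union> Z2 \<longrightarrow> Z = Z1 \<or> Z = Z2)"

text \<open>
  Codimension in the Zariski topology: for an irreducible closed set \<open>Z\<close>, the supremum of the
  lengths \<open>r\<close> of chains \<open>Z = C 0 \<subset> \<dots> \<subset> C r\<close> of irreducible closed subsets of affine space; for a
  closed set \<open>V\<close>, the infimum over the irreducible closed subsets of \<open>V\<close> (\<open>\<infinity>\<close> if \<open>V\<close> is empty).
\<close>

definition codim_irreducible :: "(complex ^ 'm::finite) set \<Rightarrow> enat" where
  "codim_irreducible Z =
     Sup {enat r | r. \<exists>C :: nat \<Rightarrow> (complex ^ 'm) set. C 0 = Z \<and>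
            (\<forall>k\<le>r. irreducible_algebraic_set (C k)) \<and> (\<forall>k<r. C k \<subset> C (Suc k))}"

definition codim :: "(complex ^ 'm::finite) set \<Rightarrow> enat" where
  "codim V = (INF Z\<in>{Z. irreducible_algebraic_set Z \<and> Z \<subseteq> V}. codim_irreducible Z)"


section \<open>Codimension one foliations on projective space\<close>

text \<open>The family \<open>A\<close> of coefficients represents the 1-form \<open>\<omega> = \<Sum>k. A k dz_k\<close>.\<close>

definition one_form ::
  "('m::finite \<Rightarrow> complex ^ 'm \<Rightarrow> complex) \<Rightarrow> complex ^ 'm \<Rightarrow> complex ^ 'm \<Rightarrow> complex" where
  "one_form A z v = (\<Sum>k\<in>UNIV. A k z * v $ k)"

definition ext_deriv ::
  "(complex ^ 'm::finite \<Rightarrow> complex ^ 'm \<Rightarrow> complex) \<Rightarrow>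
     complex ^ 'm \<Rightarrow> complex ^ 'm \<Rightarrow> complex ^ 'm \<Rightarrow> complex" where
  "ext_deriv \<omega> z u v =
     deriv (\<lambda>t. \<omega> (z + t *s u) v) 0 - deriv (\<lambda>t. \<omega> (z + t *s v) u) 0"

text \<open>The wedge product of a linear form with an alternating bilinear form.\<close>

definition wedge12 ::
  "('v \<Rightarrow> complex) \<Rightarrow> ('v \<Rightarrow> 'v \<Rightarrow> complex) \<Rightarrow> 'v \<Rightarrow> 'v \<Rightarrow> 'v \<Rightarrow> complex" where
  "wedge12 \<alpha> \<beta> u v w = \<alpha> u * \<beta> v w + \<alpha> v * \<beta> w u + \<alpha> w * \<beta> u v"

definition singular_set :: "('m::finite \<Rightarrow> complex ^ 'm \<Rightarrow> complex) \<Rightarrow> (complex ^ 'm) set" where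
  "singular_set A = {z. \<forall>k. A k z = 0}"

definition codim_one_foliation ::
  "nat \<Rightarrow> ('m::finite \<Rightarrow> complex ^ 'm \<Rightarrow> complex) \<Rightarrow> bool" where
  "codim_one_foliation \<nu> A \<longleftrightarrow>
     (\<forall>k. homogeneous_fun (\<nu> + 1) (A k)) \<and>
     (\<forall>z u v w. wedge12 (one_form A z) (ext_deriv (one_form A) z) u v w = 0) \<and>
     (\<forall>z. (\<Sum>k\<in>UNIV. z $ k * A k z) = 0) \<and>
     codim (singular_set A) \<ge> 2"


section \<open>Holomorphic vector fields on projective space\<close>

text \<open>
  The chart \<open>{[z]. z $ i \<noteq> 0}\<close> of \<open>CP(n)\<close> is identified with the affine hyperplane \<open>{w. w $ i = 1}\<close>
  (a copy of \<open>C^n\<close>, with tangent space \<open>{v. v $ i = 0}\<close>) by \<open>[z] \<mapsto> z / z_i\<close>.  In these charts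
  \<open>affine_coord j\<close>, restricted to \<open>{w \<in> chart i. w $ j \<noteq> 0}\<close>, is the transition map from chart \<open>i\<close>
  to chart \<open>j\<close>.
\<close>

definition chart :: "'m::finite \<Rightarrow> (complex ^ 'm) set" where
  "chart i = {w. w $ i = 1}"

definition affine_coord :: "'m::finite \<Rightarrow> complex ^ 'm \<Rightarrow> complex ^ 'm" where
  "affine_coord i z = inverse (z $ i) *s z"

definition holomorphic_map_on ::
  "(complex ^ 'm::finite) set \<Rightarrow> (complex ^ 'm \<Rightarrow> complex ^ 'm) \<Rightarrow> bool" where
  "holomorphic_map_on S f \<longleftrightarrow>
     (\<forall>w\<in>S. \<exists>D. (f has_derivative D) (at w within S) \<and> (\<forall>c v. D (c *s v) = c *s D v))"

text \<open>
  The complex derivative of \<open>f\<close> at \<open>w\<close> in the direction \<open>v\<close>.  For \<open>w \<in> chart i\<close> and \<open>v $ i = 0\<close> it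
  only involves the values of \<open>f\<close> on \<open>chart i\<close>.
\<close>

definition dir_deriv ::
  "(complex ^ 'm::finite \<Rightarrow> complex ^ 'm) \<Rightarrow> complex ^ 'm \<Rightarrow> complex ^ 'm \<Rightarrow> complex ^ 'm" where
  "dir_deriv f w v = (\<chi> k. deriv (\<lambda>t. f (w + t *s v) $ k) 0)"

text \<open>
  A vector field is the family \<open>X\<close> of its local expressions \<open>X i\<close> in the charts; these are related by
  the differentials of the transition maps, and are normalised to be \<open>0\<close> off \<open>chart i\<close> so
  that equal vector fields are equal families.
\<close>

type_synonym 'm vfield = "'m \<Rightarrow> complex ^ 'm \<Rightarrow> complex ^ 'm"

definition hol_vector_fields :: "('m::finite) vfield set" where
  "hol_vector_fields = {X.
     (\<forall>i. holomorphic_map_on (chart i) (X i)) \<and>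
     (\<forall>i. \<forall>w\<in>chart i. X i w $ i = 0) \<and>
     (\<forall>i. \<forall>w. w \<notin> chart i \<longrightarrow> X i w = 0) \<and>
     (\<forall>i j. \<forall>w\<in>chart i. w $ j \<noteq> 0 \<longrightarrow>
        X j (affine_coord j w) = dir_deriv (affine_coord j) w (X i w))}"

definition lie_bracket :: "('m::finite) vfield \<Rightarrow> 'm vfield \<Rightarrow> 'm vfield" where
  "lie_bracket X Y = (\<lambda>i w. if w \<in> chart i
     then dir_deriv (Y i) w (X i w) - dir_deriv (X i) w (Y i w) else 0)"

definition lie_subalgebra :: "('m::finite) vfield set \<Rightarrow> bool" where
  "lie_subalgebra L \<longleftrightarrow>
     L \<subseteq> hol_vector_fields \<and>
     (\<lambda>i w. 0) \<in> L \<and>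
     (\<forall>X\<in>L. \<forall>Y\<in>L. (\<lambda>i w. X i w + Y i w) \<in> L) \<and>
     (\<forall>c. \<forall>X\<in>L. (\<lambda>i w. c *s X i w) \<in> L) \<and>
     (\<forall>X\<in>L. \<forall>Y\<in>L. lie_bracket X Y \<in> L)"


section \<open>\<open>L\<close>-foliations\<close>

text \<open>
  The following two subspaces of the tangent space of \<open>CP(n)\<close> at \<open>[z]\<close> are expressed in the chart
  \<open>i\<close>, where \<open>z $ i \<noteq> 0\<close>; there the foliation is defined by the restriction of \<open>\<omega>\<close> to \<open>chart i\<close>.
\<close>

definition values_at :: "('m::finite) vfield set \<Rightarrow> 'm \<Rightarrow> complex ^ 'm \<Rightarrow> (complex ^ 'm) set" where
  "values_at L i z = {X i (affine_coord i z) | X. X \<in> L}"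

definition leaf_tangent_space ::
  "('m::finite \<Rightarrow> complex ^ 'm \<Rightarrow> complex) \<Rightarrow> 'm \<Rightarrow> complex ^ 'm \<Rightarrow> (complex ^ 'm) set" where
  "leaf_tangent_space A i z = {v. v $ i = 0 \<and> one_form A (affine_coord i z) v = 0}"

text \<open>A property of \<open>[z]\<close> is generic if it holds off a proper algebraic subset of \<open>CP(n)\<close>.\<close>

definition generic :: "(complex ^ 'm::finite \<Rightarrow> bool) \<Rightarrow> bool" where
  "generic \<Phi> \<longleftrightarrow>
     (\<exists>d P. homogeneous_fun d P \<and> (\<exists>z. P z \<noteq> 0) \<and> (\<forall>z. z \<noteq> 0 \<and> P z \<noteq> 0 \<longrightarrow> \<Phi> z))"

text \<open>
  A leaf passes through \<open>[z]\<close> only if \<open>z\<close> is not singular, and its tangent space then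
  has dimension \<open>n - 1\<close>.
\<close>

definition L_foliation :: "('m::finite \<Rightarrow> complex ^ 'm \<Rightarrow> complex) \<Rightarrow> bool" where
  "L_foliation A \<longleftrightarrow>
     (\<exists>L. lie_subalgebra L \<and>
        generic (\<lambda>z. z \<notin> singular_set A \<and>
          (\<forall>i. z $ i \<noteq> 0 \<longrightarrow> values_at L i z = leaf_tangent_space A i z)))"

end

theory Submission
  imports Defs
begin

text \<open>
  Let \<open>\<omega>\<close> be the form of the foliation. The Lie algebra consists of all linear vector fields \<open>B\<close> on
  \<open>C^(n+1)\<close> with \<open>\<omega>(B) = 0\<close>, projected to \<open>CP(n)\<close>. By integrability it is closed under the bracket
  (\<open>commutator_annihilators\<close>), and projection turns commutators of linear maps into brackets
  of fields (\<open>lie_bracket_linear_field\<close>).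

  The degree enters in showing that there are enough such \<open>B\<close>: in degree \<open>1\<close> the two-form
  \<open>d\<omega>\<close> has linear coefficients, so for constant vectors \<open>u, v, w\<close> the field
  \<open>d\<omega>(v, w) u + d\<omega>(w, u) v + d\<omega>(u, v) w\<close> is linear, and its value under \<open>\<omega>\<close> is
  \<open>(\<omega> \<and> d\<omega>)(u, v, w) = 0\<close>. Take for \<open>u\<close> the point \<open>z\<close> at which the field is evaluated, for \<open>v\<close>
  a vector with \<open>\<omega>\<^sub>z(v) \<noteq> 0\<close>, and for \<open>w\<close> any vector in the kernel of \<open>\<omega>\<^sub>z\<close>. Since the radial
  contraction of \<open>d\<omega>\<close> is \<open>3 \<omega>\<close> (\<open>d\<omega>_radial\<close>), the value of the field at \<open>z\<close> is \<open>3 \<omega>\<^sub>z(v) w\<close>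
  modulo the radial direction. Thus the fields fill the tangent space of the leaf wherever
  \<open>\<omega>\<^sub>z \<noteq> 0\<close> (\<open>values_annihilators\<close>). This happens off the zeros of some coefficient of \<open>\<omega>\<close>, because
  the condition on the codimension of the singular set excludes \<open>\<omega> = 0\<close>: the whole space
  is irreducible, hence of codimension \<open>0\<close>.
\<close>

section \<open>The coefficients of a degree one foliation do not all vanish\<close>

lemma polynomial_fun_on_line:
  fixes a b :: "complex ^ 'm::finite"
  assumes "polynomial_fun f"
  shows "\<exists>p. \<forall>t. f (a + t *s b) = poly p t"
proof -
  obtain S c where "finite S" and f: "f = (\<lambda>z. \<Sum>e\<in>S. c e * monomial_fun e z)"
    using assms unfolding polynomial_fun_def by blast
  have "f (a + t *s b) = poly (\<Sum>e\<in>S. smult (c e) (\<Prod>i\<in>UNIV. [:a $ i, b $ i:] ^ e i)) t" for t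
    unfolding f monomial_fun_def by (simp add: poly_sum poly_prod)
  then show ?thesis by blast
qed

lemma algebraic_set_UNIV: "algebraic_set UNIV"
  unfolding algebraic_set_def by (rule exI[of _ "{}"]) simp

text \<open>
  If neither of two algebraic sets is the whole space, each has an equation that is nonzero somewhere;
  on the line through two such points both equations become nonzero polynomials in one variable,
  whose product is nonzero at some point.
\<close>

lemma irreducible_algebraic_set_UNIV:
  "irreducible_algebraic_set (UNIV :: (complex ^ 'm::finite) set)"
  unfolding irreducible_algebraic_set_def
proof (intro conjI allI impI algebraic_set_UNIV)
  show "(UNIV :: (complex ^ 'm) set) \<noteq> {}" by simp
next
  fix Z1 Z2 :: "(complex ^ 'm) set"
  assume "algebraic_set Z1" "algebraic_set Z2" and un: "UNIV = Z1 \<union> Z2"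
  then obtain F1 F2
    where F1: "\<forall>f\<in>F1. polynomial_fun f" "Z1 = {z. \<forall>f\<in>F1. f z = 0}"
      and F2: "\<forall>f\<in>F2. polynomial_fun f" "Z2 = {z. \<forall>f\<in>F2. f z = 0}"
    unfolding algebraic_set_def by (elim exE conjE) (rule that)
  show "UNIV = Z1 \<or> UNIV = Z2"
  proof (rule ccontr)
    assume "\<not> ?thesis"
    then obtain f g a b where f: "f \<in> F1" "f a \<noteq> 0" and g: "g \<in> F2" "g b \<noteq> 0"
      using F1(2) F2(2) by auto
    obtain p where p: "\<And>t. f (a + t *s (b - a)) = poly p t"
      using polynomial_fun_on_line[of f a "b - a"] F1(1) f(1) by blast
    obtain q where q: "\<And>t. g (a + t *s (b - a)) = poly q t"
      using polynomial_fun_on_line[of g a "b - a"] F2(1) g(1) by blast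
    have "poly p 0 \<noteq> 0" "poly q 1 \<noteq> 0"
      using p[of 0] q[of 1] f(2) g(2) by auto
    then have "p * q \<noteq> 0" by auto
    then obtain t where "poly (p * q) t \<noteq> 0"
      using poly_all_0_iff_0 by blast
    then have "f (a + t *s (b - a)) \<noteq> 0" "g (a + t *s (b - a)) \<noteq> 0"
      using p q by auto
    then have "a + t *s (b - a) \<notin> Z1 \<union> Z2"
      using F1(2) F2(2) f(1) g(1) by blast
    then show False using un by blast
  qed
qed

lemma codim_UNIV: "codim (UNIV :: (complex ^ 'm::finite) set) = 0"
proof -
  have "codim_irreducible (UNIV :: (complex ^ 'm) set) \<le> 0"
    unfolding codim_irreducible_def
  proof (rule Sup_least, clarify)
    fix r and C :: "nat \<Rightarrow> (complex ^ 'm) set"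
    assume "C 0 = UNIV" "\<forall>k<r. C k \<subset> C (Suc k)"
    then have "r = 0" by (metis gr0I psubsetE subset_UNIV)
    then show "enat r \<le> 0" by (simp add: zero_enat_def)
  qed
  moreover have "codim (UNIV :: (complex ^ 'm) set) \<le> codim_irreducible (UNIV :: (complex ^ 'm) set)"
    unfolding codim_def by (rule INF_lower) (simp add: irreducible_algebraic_set_UNIV)
  ultimately have "codim (UNIV :: (complex ^ 'm) set) \<le> 0" by (rule order_trans[rotated])
  then show ?thesis by simp
qed

lemma codim_one_foliation_nonzero:
  assumes "codim_one_foliation \<nu> A"
  obtains k z where "A k z \<noteq> 0"
proof -
  have "codim (singular_set A) \<ge> 2"
    using assms by (simp add: codim_one_foliation_def)
  then have "singular_set A \<noteq> UNIV"
    using codim_UNIV by (metis not_numeral_le_zero)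
  then have "\<exists>z k. A k z \<noteq> 0" by (auto simp: singular_set_def)
  then obtain z k where "A k z \<noteq> 0" by (elim exE)
  then show ?thesis by (rule that)
qed

section \<open>Linear vector fields on projective space\<close>

abbreviation clinear :: "(complex ^ 'm::finite \<Rightarrow> complex ^ 'm) \<Rightarrow> bool" where
  "clinear \<equiv> Vector_Spaces.linear (*s) (*s)"

lemma clinear_iff:
  "clinear B \<longleftrightarrow> (\<forall>u v. B (u + v) = B u + B v) \<and> (\<forall>c u. B (c *s u) = c *s B u)"
  by (simp add: Vector_Spaces.linear_iff vec.vector_space_axioms)

text \<open>
  The projection of the linear vector field \<open>B\<close> to projective space: in \<open>chart i\<close> the multiple of the
  radial field \<open>w\<close> is subtracted that makes the result tangent to \<open>{w. w $ i = 1}\<close>.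
\<close>

definition linear_field :: "(complex ^ 'm::finite \<Rightarrow> complex ^ 'm) \<Rightarrow> 'm vfield" where
  "linear_field B = (\<lambda>i w. if w \<in> chart i then B w - (B w $ i) *s w else 0)"

lemma bounded_linear_clinear:
  assumes "clinear B"
  shows "bounded_linear (B :: complex ^ 'm::finite \<Rightarrow> complex ^ 'm)"
proof -
  have scaleR: "c *\<^sub>R v = complex_of_real c *s v" for c :: real and v :: "complex ^ 'm"
    unfolding vec_eq_iff vector_scaleR_component vector_smult_component
    by (intro allI scaleR_conv_of_real)
  have "linear B"
  proof (rule linearI)
    show "B (u + v) = B u + B v" for u v by (rule vec.linear_add[OF assms])
    show "B (c *\<^sub>R v) = c *\<^sub>R B v" for c v
      unfolding scaleR by (rule vec.linear_scale[OF assms])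
  qed
  then show ?thesis by (rule linear_conv_bounded_linear[THEN iffD1])
qed

lemma holomorphic_linear_field:
  fixes B :: "complex ^ 'm::finite \<Rightarrow> complex ^ 'm"
  assumes B: "clinear B"
  shows "holomorphic_map_on (chart i) (linear_field B i)"
  unfolding holomorphic_map_on_def
proof
  fix w :: "complex ^ 'm" assume w: "w \<in> chart i"
  let ?g = "\<lambda>w. B w - (B w $ i) *s w"
  let ?D = "\<lambda>v. B v - (B v $ i) *s w - (B w $ i) *s v"
  have B': "(B has_derivative B) (at w within chart i)"
    using bounded_linear_clinear[OF B] by (rule bounded_linear_imp_has_derivative)
  have "((\<lambda>w. ?g w $ k) has_derivative (\<lambda>v. ?D v $ k)) (at w within chart i)" for k
    unfolding vector_minus_component vector_smult_component
    by (rule derivative_eq_intros bounded_linear.has_derivative[OF bounded_linear_vec_nth] B'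
        has_derivative_ident refl)+ (simp add: fun_eq_iff algebra_simps)
  then have "(?g has_derivative ?D) (at w within chart i)"
    by (subst has_derivative_componentwise_within)
      (auto simp: Basis_vec_def inner_axis intro!: has_derivative_inner_left)
  then have "(linear_field B i has_derivative ?D) (at w within chart i)"
    by (rule has_derivative_transform[OF w, rotated]) (simp add: linear_field_def)
  moreover have "?D (c *s v) = c *s ?D v" for c v
    by (simp add: vec_eq_iff vec.linear_scale[OF B] algebra_simps)
  ultimately show "\<exists>D. (linear_field B i has_derivative D) (at w within chart i) \<and>
      (\<forall>c v. D (c *s v) = c *s D v)" by blast
qed

lemma dir_deriv_affine_coord:
  assumes "w $ j \<noteq> 0"
  shows "dir_deriv (affine_coord j) w v
    = inverse (w $ j) *s v - (v $ j * inverse (w $ j) ^ 2) *s w"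
proof -
  have "((\<lambda>t. affine_coord j (w + t *s v) $ k) has_field_derivative
      inverse (w $ j) * v $ k - v $ j * inverse (w $ j) ^ 2 * w $ k) (at 0)" for k
    unfolding affine_coord_def vector_add_component vector_smult_component using assms
    by (auto intro!: derivative_eq_intros simp: power2_eq_square algebra_simps)
  then show ?thesis
    by (simp add: dir_deriv_def vec_eq_iff DERIV_imp_deriv)
qed

text \<open>The chart expressions agree because \<open>affine_coord j\<close> contracts the radial direction.\<close>

lemma linear_field_hol_vector_fields:
  assumes B: "clinear B"
  shows "linear_field B \<in> hol_vector_fields"
proof -
  have "linear_field B j (affine_coord j w) = dir_deriv (affine_coord j) w (linear_field B i w)"
    if "w \<in> chart i" "w $ j \<noteq> 0" for i j w
    using that
    by (simp add: dir_deriv_affine_coord linear_field_def affine_coord_def chart_def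
        vec.linear_scale[OF B] vec_eq_iff power2_eq_square field_simps)
  then show ?thesis
    using holomorphic_linear_field[OF B]
    by (auto simp: hol_vector_fields_def linear_field_def chart_def)
qed

lemma dir_deriv_linear_field:
  assumes C: "clinear C" and w: "w \<in> chart i" and v: "v $ i = 0"
  shows "dir_deriv (linear_field C i) w v = C v - (C v $ i) *s w - (C w $ i) *s v"
proof -
  have eq: "linear_field C i (w + t *s v) $ k
      = C w $ k + t * C v $ k - (C w $ i + t * C v $ i) * (w $ k + t * v $ k)" for t k
    using w v by (simp add: linear_field_def chart_def vec.linear_scale[OF C] vec.linear_add[OF C])
      (simp add: algebra_simps)
  have "((\<lambda>t. linear_field C i (w + t *s v) $ k) has_field_derivative
      C v $ k - C v $ i * w $ k - C w $ i * v $ k) (at 0)" for k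
    unfolding eq by (auto intro!: derivative_eq_intros simp: algebra_simps)
  then show ?thesis
    by (simp add: dir_deriv_def vec_eq_iff DERIV_imp_deriv)
qed

lemma lie_bracket_linear_field:
  fixes B C :: "complex ^ 'm::finite \<Rightarrow> complex ^ 'm"
  assumes B: "clinear B" and C: "clinear C"
  shows "lie_bracket (linear_field B) (linear_field C) = linear_field (\<lambda>z. C (B z) - B (C z))"
proof (intro ext)
  fix i and w :: "complex ^ 'm"
  show "lie_bracket (linear_field B) (linear_field C) i w
    = linear_field (\<lambda>z. C (B z) - B (C z)) i w"
  proof (cases "w \<in> chart i")
    case True
    have v: "linear_field D i w $ i = 0" for D
      using True by (simp add: linear_field_def chart_def)
    show ?thesis using True
      unfolding lie_bracket_def
      by (simp add: dir_deriv_linear_field[OF B True v] dir_deriv_linear_field[OF C True v])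
        (simp add: linear_field_def vec_eq_iff algebra_simps
          vec.linear_diff[OF B] vec.linear_diff[OF C] vec.linear_scale[OF B] vec.linear_scale[OF C])
  qed (simp add: lie_bracket_def linear_field_def)
qed

section \<open>One-forms with quadratic coefficients\<close>

lemma homogeneous_monomial_Suc:
  fixes e :: "'m::finite \<Rightarrow> nat"
  assumes "(\<Sum>i\<in>UNIV. e i) = Suc d"
  obtains j e' where "(\<Sum>i\<in>UNIV. e' i) = d"
    "\<And>z. monomial_fun e z = z $ j * monomial_fun e' z"
proof -
  have "\<exists>j. e j \<noteq> 0"
    using assms by (metis sum.neutral nat.distinct(1))
  then obtain j n where j: "e j = Suc n"
    using not0_implies_Suc by blast
  let ?e = "e(j := n)"
  have rest: "sum e (- {j}) = sum ?e (- {j})"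
    by (rule sum.cong) auto
  have "(\<Sum>i\<in>UNIV. e i) = Suc (\<Sum>i\<in>UNIV. ?e i)"
    using sum.remove[of UNIV j e] sum.remove[of UNIV j ?e] j rest by (simp add: Compl_eq_Diff_UNIV)
  moreover have "monomial_fun e z = z $ j * monomial_fun ?e z" for z
  proof -
    have "(\<Prod>i\<in>UNIV - {j}. z $ i ^ e i) = (\<Prod>i\<in>UNIV - {j}. z $ i ^ ?e i)"
      by (rule prod.cong) auto
    then show ?thesis
      using prod.remove[of UNIV j "\<lambda>i. z $ i ^ e i"] prod.remove[of UNIV j "\<lambda>i. z $ i ^ ?e i"] j
      by (simp add: monomial_fun_def mult.assoc)
  qed
  ultimately show ?thesis using that[of ?e j] assms by simp
qed

lemma homogeneous_monomial_2:
  fixes e :: "'m::finite \<Rightarrow> nat"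
  assumes "(\<Sum>i\<in>UNIV. e i) = 2"
  shows "\<exists>p q. \<forall>z. monomial_fun e z = z $ p * z $ q"
proof -
  obtain p e1 where 1: "(\<Sum>i\<in>UNIV. e1 i) = 1" "\<And>z. monomial_fun e z = z $ p * monomial_fun e1 z"
    using homogeneous_monomial_Suc[of e 1] assms by (metis Suc_1)
  obtain q e2 where 2: "(\<Sum>i\<in>UNIV. e2 i) = 0" "\<And>z. monomial_fun e1 z = z $ q * monomial_fun e2 z"
    using homogeneous_monomial_Suc[of e1 0] 1(1) by (metis One_nat_def)
  have "monomial_fun e2 z = 1" for z :: "complex ^ 'm"
    using 2(1) by (simp add: monomial_fun_def)
  then show ?thesis using 1(2) 2(2) by (metis mult.right_neutral)
qed

locale symmetric_bilinear =
  fixes S :: "complex ^ 'm::finite \<Rightarrow> complex ^ 'm \<Rightarrow> complex"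
  assumes commute: "S u v = S v u"
    and add_right: "S u (v + w) = S u v + S u w"
    and scale_right: "S u (c *s v) = c * S u v"

lemma homogeneous_fun_2_polar:
  fixes f :: "complex ^ 'm::finite \<Rightarrow> complex"
  assumes "homogeneous_fun 2 f"
  shows "\<exists>S. symmetric_bilinear S \<and> (\<forall>z. f z = S z z)"
proof -
  obtain E c where E: "\<forall>e\<in>E. (\<Sum>i\<in>UNIV. e i) = 2"
    and f: "f = (\<lambda>z. \<Sum>e\<in>E. c e * monomial_fun e z)"
    using assms unfolding homogeneous_fun_def by blast
  obtain p q where pq: "\<And>e z. e \<in> E \<Longrightarrow> monomial_fun e z = z $ p e * z $ q e"
    using E homogeneous_monomial_2 by metis
  define S where "S = (\<lambda>u v. \<Sum>e\<in>E. c e * (u $ p e * v $ q e + u $ q e * v $ p e) / 2)"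
  have "symmetric_bilinear S"
    by unfold_locales
      (auto simp: S_def sum_distrib_left algebra_simps add_divide_distrib simp flip: sum.distrib
        intro!: sum.cong)
  moreover have "f z = S z z" for z
    unfolding f S_def by (intro sum.cong) (auto simp: pq algebra_simps)
  ultimately show ?thesis by blast
qed

text \<open>
  The polarisation \<open>T\<close> of a one-form \<open>\<omega>\<close> with quadratic coefficients, so that \<open>\<omega>\<^sub>z(v) = T z z v\<close>.
  In terms of \<open>T\<close> the exterior derivative is algebraic.
\<close>

locale quadratic_one_form =
  fixes T :: "complex ^ 'm::finite \<Rightarrow> complex ^ 'm \<Rightarrow> complex ^ 'm \<Rightarrow> complex"
  assumes commute: "T u v w = T v u w"
    and add_middle: "T u (v + v') w = T u v w + T u v' w"
    and scale_middle: "T u (c *s v) w = c * T u v w"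
    and add_right: "T u v (w + w') = T u v w + T u v w'"
    and scale_right: "T u v (c *s w) = c * T u v w"
begin

lemma add_left: "T (u + u') v w = T u v w + T u' v w"
  by (metis commute add_middle)

lemma scale_left: "T (c *s u) v w = c * T u v w"
  by (metis commute scale_middle)

lemma diff_right: "T u v (w - w') = T u v w - T u v w'"
  using add_right[of u v w "(-1) *s w'"] scale_right[of u v "-1" w'] by simp

lemmas multilinear = add_left add_middle add_right scale_left scale_middle scale_right

lemma compose_right:
  assumes "clinear B"
  shows "quadratic_one_form (\<lambda>u v w. T u v (B w))"
  using assms
  by unfold_locales (auto simp: commute multilinear vec.linear_add vec.linear_scale)

text \<open>
  The derivative of the vanishing cubic form \<open>z \<mapsto> T z z z\<close> in the direction \<open>v\<close>, obtained
  as the part of its value at \<open>z + v\<close> that is odd in \<open>v\<close>.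
\<close>

lemma polarize_zero:
  assumes 0: "\<And>z. T z z z = 0"
  shows "T z z v = - 2 * T z v z"
proof -
  have "T (z + c *s v) (z + c *s v) (z + c *s v)
      = T z z z + c * (2 * T z v z + T z z v) + c ^ 2 * (2 * T z v v + T v v z) + c ^ 3 * T v v v" for c
    by (simp add: multilinear commute[of v z] algebra_simps power2_eq_square power3_eq_cube)
  then have "c * (2 * T z v z + T z z v) + c ^ 2 * (2 * T z v v + T v v z) = 0" for c
    by (simp add: 0)
  from this[of 1] this[of "-1"] have "2 * (2 * T z v z + T z z v) = 0"
    by (simp add: algebra_simps) algebra
  then show ?thesis by (simp add: add_eq_0_iff2)
qed

lemma ext_deriv_eq:
  assumes "\<And>z v. \<omega> z v = T z z v"
  shows "ext_deriv \<omega> z u v = 2 * T z u v - 2 * T z v u"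
proof -
  have "((\<lambda>t. \<omega> (z + t *s u) v) has_field_derivative 2 * T z u v) (at 0)" for u v
    unfolding assms multilinear
    by (auto intro!: derivative_eq_intros simp: commute[of u z])
  from DERIV_imp_deriv[OF this] show ?thesis by (simp add: ext_deriv_def)
qed

end

lemma one_form_polarization:
  fixes A :: "'m::finite \<Rightarrow> complex ^ 'm \<Rightarrow> complex"
  assumes "\<And>k. homogeneous_fun 2 (A k)"
  shows "\<exists>T. quadratic_one_form T \<and> (\<forall>z v. one_form A z v = T z z v)"
proof -
  obtain S where S: "\<And>k. symmetric_bilinear (S k)" and A: "\<And>k z. A k z = S k z z"
    using homogeneous_fun_2_polar[OF assms] by metis
  define T where "T = (\<lambda>u v w :: complex ^ 'm. \<Sum>k\<in>UNIV. S k u v * w $ k)"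
  have "quadratic_one_form T"
    by unfold_locales
      (auto simp: T_def symmetric_bilinear.commute[OF S, of _ "_ + _"]
        symmetric_bilinear.add_right[OF S] symmetric_bilinear.scale_right[OF S]
        sum_distrib_left algebra_simps simp flip: sum.distrib
        intro!: sum.cong symmetric_bilinear.commute[OF S])
  moreover have "one_form A z v = T z z v" for z v
    by (simp add: one_form_def T_def A)
  ultimately show ?thesis by blast
qed

section \<open>Integrable quadratic one-forms\<close>

locale integrable_quadratic_one_form = quadratic_one_form +
  assumes radial: "T z z z = 0"
    and integrable: "wedge12 (T z z) (\<lambda>u v. 2 * T z u v - 2 * T z v u) u v w = 0"
begin

abbreviation d\<omega> :: "complex ^ 'a \<Rightarrow> complex ^ 'a \<Rightarrow> complex ^ 'a \<Rightarrow> complex" where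
  "d\<omega> z u v \<equiv> 2 * T z u v - 2 * T z v u"

text \<open>Euler's identity: contracting \<open>d\<omega>\<close> with the radial field gives \<open>3 \<omega>\<close>.\<close>

lemma d\<omega>_radial: "d\<omega> z z v = 3 * T z z v"
  using polarize_zero[OF radial, of z v] by simp

definition annihilators :: "(complex ^ 'a \<Rightarrow> complex ^ 'a) set" where
  "annihilators = {B. clinear B \<and> (\<forall>z. T z z (B z) = 0)}"

text \<open>
  Differentiating \<open>\<omega>\<^sub>z(B z) = 0\<close> along \<open>C z\<close> and \<open>\<omega>\<^sub>z(C z) = 0\<close> along \<open>B z\<close> shows that
  \<open>\<omega>\<close> takes the value \<open>d\<omega>(C z, B z)\<close> on the commutator. Integrability, evaluated on \<open>u, C z, B z\<close>,
  makes this zero as soon as \<open>\<omega>\<^sub>z u \<noteq> 0\<close> for some \<open>u\<close>.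
\<close>

lemma commutator_annihilators:
  assumes "B \<in> annihilators" "C \<in> annihilators"
  shows "(\<lambda>z. C (B z) - B (C z)) \<in> annihilators"
proof -
  have B: "clinear B" "\<And>z. T z z (B z) = 0" and C: "clinear C" "\<And>z. T z z (C z) = 0"
    using assms by (auto simp: annihilators_def)
  interpret TB: quadratic_one_form "\<lambda>u v w. T u v (B w)" by (rule compose_right[OF B(1)])
  interpret TC: quadratic_one_form "\<lambda>u v w. T u v (C w)" by (rule compose_right[OF C(1)])
  have "T z z (C (B z) - B (C z)) = 0" for z
  proof (cases "\<exists>u. T z z u \<noteq> 0")
    case True
    then obtain u where "T z z u \<noteq> 0" by blast
    moreover have "T z z u * d\<omega> z (C z) (B z) = 0"
      using integrable[of z u "C z" "B z"] B(2) C(2) by (simp add: wedge12_def)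
    ultimately have "d\<omega> z (C z) (B z) = 0" by simp
    then show ?thesis
      using TB.polarize_zero[OF B(2), of z "C z"] TC.polarize_zero[OF C(2), of z "B z"]
      by (simp add: diff_right)
  qed simp
  moreover have "clinear (\<lambda>z. C (B z) - B (C z))"
    unfolding clinear_iff using B(1) C(1)
    by (simp add: vec.linear_add vec.linear_scale vec.scale_right_diff_distrib)
  ultimately show ?thesis by (simp add: annihilators_def)
qed

lemma zero_annihilators: "(\<lambda>z. 0) \<in> annihilators"
  using scale_right[of _ _ 0] by (auto simp: annihilators_def clinear_iff)

lemma add_annihilators:
  "B \<in> annihilators \<Longrightarrow> C \<in> annihilators \<Longrightarrow> (\<lambda>z. B z + C z) \<in> annihilators"
  by (auto simp: annihilators_def add_right clinear_iff vec.scale_right_distrib)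

lemma scale_annihilators: "B \<in> annihilators \<Longrightarrow> (\<lambda>z. c *s B z) \<in> annihilators"
  by (auto simp: annihilators_def scale_right clinear_iff vec.scale_right_distrib mult.commute)

lemma lie_subalgebra_annihilators: "lie_subalgebra (linear_field ` annihilators)"
  unfolding lie_subalgebra_def
proof (intro conjI ballI allI)
  show "linear_field ` annihilators \<subseteq> hol_vector_fields"
    by (auto simp: annihilators_def linear_field_hol_vector_fields)
  have "(\<lambda>i w. 0) = linear_field (\<lambda>z. 0)"
    by (simp add: linear_field_def fun_eq_iff)
  then show "(\<lambda>i w. 0) \<in> linear_field ` annihilators"
    using zero_annihilators by blast
next
  fix X Y assume "X \<in> linear_field ` annihilators" "Y \<in> linear_field ` annihilators"
  then obtain B C where B: "B \<in> annihilators" "X = linear_field B"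
    and C: "C \<in> annihilators" "Y = linear_field C" by blast
  have "(\<lambda>i w. X i w + Y i w) = linear_field (\<lambda>z. B z + C z)"
    by (simp add: linear_field_def fun_eq_iff B C vec_eq_iff algebra_simps)
  then show "(\<lambda>i w. X i w + Y i w) \<in> linear_field ` annihilators"
    using add_annihilators[OF B(1) C(1)] by blast
  have "lie_bracket X Y = linear_field (\<lambda>z. C (B z) - B (C z))"
    using B C by (simp add: annihilators_def lie_bracket_linear_field)
  then show "lie_bracket X Y \<in> linear_field ` annihilators"
    using commutator_annihilators[OF B(1) C(1)] by blast
next
  fix c X assume "X \<in> linear_field ` annihilators"
  then obtain B where B: "B \<in> annihilators" "X = linear_field B" by blast
  have "(\<lambda>i w. c *s X i w) = linear_field (\<lambda>z. c *s B z)"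
    by (simp add: linear_field_def fun_eq_iff B vec_eq_iff algebra_simps)
  then show "(\<lambda>i w. c *s X i w) \<in> linear_field ` annihilators"
    using scale_annihilators[OF B(1)] by blast
qed

text \<open>
  The contraction of a trivector with \<open>d\<omega>\<close>: the coefficients of \<open>d\<omega>\<close> are linear, hence so is this
  field, and \<open>\<omega>\<close> takes the value \<open>(\<omega> \<and> d\<omega>)(u, v, w) = 0\<close> on it.
\<close>

definition contraction :: "complex ^ 'a \<Rightarrow> complex ^ 'a \<Rightarrow> complex ^ 'a \<Rightarrow> complex ^ 'a \<Rightarrow> complex ^ 'a"
  where "contraction u v w z = d\<omega> z v w *s u + d\<omega> z w u *s v + d\<omega> z u v *s w"

lemma contraction_annihilators: "contraction u v w \<in> annihilators"
proof -
  have "clinear (contraction u v w)"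
    unfolding clinear_iff contraction_def
    by (simp add: multilinear vec_eq_iff algebra_simps)
  moreover have "T z z (contraction u v w z) = 0" for z
    using integrable[of z u v w]
    unfolding contraction_def wedge12_def multilinear by (simp add: algebra_simps)
  ultimately show ?thesis by (simp add: annihilators_def)
qed

text \<open>
  At a point \<open>w\<close> of \<open>chart i\<close> where \<open>\<omega>\<^sub>w(u) \<noteq> 0\<close>, the contraction with \<open>w \<and> u \<and> v\<close> has the value
  \<open>3 \<omega>\<^sub>w(u) v\<close> modulo the radial direction, for every \<open>v\<close> in the kernel of \<open>\<omega>\<^sub>w\<close>.
\<close>

lemma values_annihilators:
  assumes w: "w \<in> chart i" and u: "T w w u \<noteq> 0"
  shows "{X i w | X. X \<in> linear_field ` annihilators} = {v. v $ i = 0 \<and> T w w v = 0}"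
proof (intro subset_antisym subsetI)
  fix v assume "v \<in> {X i w | X. X \<in> linear_field ` annihilators}"
  then obtain B where "B \<in> annihilators" "v = linear_field B i w" by blast
  then show "v \<in> {v. v $ i = 0 \<and> T w w v = 0}"
    using w by (simp add: annihilators_def linear_field_def chart_def diff_right scale_right radial)
next
  fix v assume "v \<in> {v. v $ i = 0 \<and> T w w v = 0}"
  then have v: "v $ i = 0" "T w w v = 0" by auto
  define a where "a = 3 * T w w u"
  define B where "B = (\<lambda>z. inverse a *s contraction w u v z)"
  have "a \<noteq> 0" using u by (simp add: a_def)
  have "d\<omega> w v w = 0" using d\<omega>_radial[of w v] v(2) by simp
  then have contraction_w: "contraction w u v w = d\<omega> w u v *s w + a *s v"
    by (simp add: contraction_def d\<omega>_radial a_def)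
  have "linear_field B i w = v"
    using w v(1) \<open>a \<noteq> 0\<close>
    by (simp add: linear_field_def chart_def B_def contraction_w vec_eq_iff field_simps)
  moreover have "B \<in> annihilators"
    unfolding B_def by (rule scale_annihilators[OF contraction_annihilators])
  ultimately show "v \<in> {X i w | X. X \<in> linear_field ` annihilators}" by blast
qed

end

theorem mainTheorem13:
  fixes A :: "'m::finite \<Rightarrow> complex ^ 'm \<Rightarrow> complex"
  assumes "codim_one_foliation 1 A"
  shows "L_foliation A"
proof -
  have hom: "\<And>k. homogeneous_fun 2 (A k)"
    and int: "\<And>z u v w. wedge12 (one_form A z) (ext_deriv (one_form A) z) u v w = 0"
    and rad: "\<And>z. one_form A z z = 0"
    using assms by (simp_all add: codim_one_foliation_def one_form_def mult.commute numeral_2_eq_2)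
  obtain T where "quadratic_one_form T" and T: "\<And>z v. one_form A z v = T z z v"
    using one_form_polarization[where A = A, OF hom] by blast
  then interpret quadratic_one_form T by simp
  interpret integrable_quadratic_one_form T
  proof
    show "T z z z = 0" for z using rad T by simp
    show "wedge12 (T z z) (\<lambda>u v. 2 * T z u v - 2 * T z v u) u v w = 0" for z u v w
      using int[of z u v w] by (simp add: wedge12_def ext_deriv_eq[OF T] T)
  qed
  obtain k z0 where k: "A k z0 \<noteq> 0"
    using codim_one_foliation_nonzero[OF assms] .
  let ?L = "linear_field ` annihilators"
  have axis: "A k z = T z z (axis k 1)" for z
    by (simp add: one_form_def axis_def if_distrib cong: if_cong flip: T)
  have "z \<notin> singular_set A \<and> (\<forall>i. z $ i \<noteq> 0 \<longrightarrow> values_at ?L i z = leaf_tangent_space A i z)"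
    if "A k z \<noteq> 0" for z
  proof (intro conjI allI impI)
    show "z \<notin> singular_set A" using that by (auto simp: singular_set_def)
    fix i assume i: "z $ i \<noteq> 0"
    have "affine_coord i z \<in> chart i" using i by (simp add: affine_coord_def chart_def)
    moreover have "T (affine_coord i z) (affine_coord i z) (axis k 1) \<noteq> 0"
      using that i by (simp add: affine_coord_def scale_left scale_middle axis)
    ultimately show "values_at ?L i z = leaf_tangent_space A i z"
      unfolding values_at_def leaf_tangent_space_def T by (rule values_annihilators)
  qed
  then have "generic (\<lambda>z. z \<notin> singular_set A \<and>
      (\<forall>i. z $ i \<noteq> 0 \<longrightarrow> values_at ?L i z = leaf_tangent_space A i z))"
    unfolding generic_def using hom k by blast
  then show ?thesis
    unfolding L_foliation_def using lie_subalgebra_annihilators by blast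
qed

end
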